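(* If $G$ is a digraph with $\delta^0(G)\ge |V(G)|/2$, then $G$ has a CISA of size $2$.
   Context: $\delta^-(G)$ and $\delta^+(G)$ are the minimum in-degree and out-degree of $G$, and $\delta^0(G)=\min\{\delta^-(G),\delta^+(G)\}$. For a directed tree $T$, $\mathrm{int}(T)$ is the set of vertices of degree at least 2 in the underlying undirected tree. An arborescence is a tree in which every vertex except one (the root, of in-degree 0) has in-degree exactly 1 in the tree. A CISA of size $k$ in a digraph $G$ is a set $\{T_1,\dots,T_k\}$ of spanning arborescences of $G$ with $\mathrm{int}(T_i)\cap\mathrm{int}(T_j)=\emptyset$ and $A(T_i)\cap A(T_j)=\emptyset$ for all distinct $i,j$. *)

theory Defs
  imports "Graph_Theory.Graph_Theory"
begin

text \<open>
  Digraphs are those of the locale \<^locale>\<open>digraph\<close>: finite, without loops and without parallel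
  arcs, but possibly with pairs of opposite arcs. That locale admits the null graph, for which
  the minima below are unspecified.
\<close>

definition min_in_degree :: "('a, 'b) pre_digraph \<Rightarrow> nat" where
  "min_in_degree G = Min (in_degree G ` verts G)"

definition min_out_degree :: "('a, 'b) pre_digraph \<Rightarrow> nat" where
  "min_out_degree G = Min (out_degree G ` verts G)"

definition min_semidegree :: "('a, 'b) pre_digraph \<Rightarrow> nat" where
  "min_semidegree G = min (min_in_degree G) (min_out_degree G)"

text \<open>
  A directed tree is an orientation of an undirected tree. The library's \<^const>\<open>tree\<close> only
  forbids directed cycles (so a transitive tournament satisfies it) and is not used here.
  \<^const>\<open>mk_symmetric\<close> represents an undirected edge by two opposite arcs, which themselves
  form a closed walk of length 2; the cycles of the underlying undirected graph are therefore
  the cycles of length at least 3.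
\<close>

definition oriented :: "('a, 'b) pre_digraph \<Rightarrow> bool" where
  "oriented T \<longleftrightarrow> digraph T \<and> (\<forall>u v. (u, v) \<in> arcs_ends T \<longrightarrow> (v, u) \<notin> arcs_ends T)"

definition directed_tree :: "('a, 'b) pre_digraph \<Rightarrow> bool" where
  "directed_tree T \<longleftrightarrow> oriented T \<and> connected T \<and>
     \<not> (\<exists>p. pre_digraph.cycle (with_proj (mk_symmetric T)) p \<and> length p \<ge> 3)"

definition tree_int :: "('a, 'b) pre_digraph \<Rightarrow> 'a set" where
  "tree_int T = {v \<in> verts T. out_degree (with_proj (mk_symmetric T)) v \<ge> 2}"

definition arborescence :: "('a, 'b) pre_digraph \<Rightarrow> bool" where
  "arborescence T \<longleftrightarrow> directed_tree T \<and>
     (\<exists>r \<in> verts T. in_degree T r = 0 \<and> (\<forall>v \<in> verts T - {r}. in_degree T v = 1))"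

definition spanning_arborescence :: "('a, 'b) pre_digraph \<Rightarrow> ('a, 'b) pre_digraph \<Rightarrow> bool" where
  "spanning_arborescence T G \<longleftrightarrow> arborescence T \<and> spanning T G"

definition CISA :: "('a, 'b) pre_digraph \<Rightarrow> nat \<Rightarrow> ('a, 'b) pre_digraph set \<Rightarrow> bool" where
  "CISA G k S \<longleftrightarrow> finite S \<and> card S = k \<and> (\<forall>T \<in> S. spanning_arborescence T G) \<and>
     (\<forall>T \<in> S. \<forall>T' \<in> S. T \<noteq> T' \<longrightarrow>
        tree_int T \<inter> tree_int T' = {} \<and> arcs T \<inter> arcs T' = {})"

end

theory Submission
  imports Defs
begin

text \<open>
  By the theorem of Ghouila-Houri, \<open>G\<close> has a Hamilton cycle. Cut it into two paths \<open>A\<close> and \<open>B\<close>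
  with at most \<open>(n + 1) / 2\<close> vertices each. A vertex of \<open>B\<close> has at least \<open>n / 2 > |B| - 1\<close>
  in-neighbours, hence one in \<open>A\<close>, so the path \<open>A\<close> extends to a spanning arborescence in which the
  vertices of \<open>B\<close> are leaves; symmetrically for \<open>B\<close>. All arcs of the first arborescence have their
  tail in \<open>A\<close> and all arcs of the second in \<open>B\<close>, so they are arc-disjoint as well.

  For Ghouila-Houri's theorem, take a longest cycle \<open>C\<close> and a longest path \<open>P\<close> outside of it. The
  in-neighbours \<open>X\<close> of the start of \<open>P\<close> and the out-neighbours \<open>Y\<close> of its end both lie on
  \<open>C \<union> P\<close>. No element of \<open>Y\<close> directly follows one of \<open>X\<close> on \<open>C\<close>, and somewhere an element of \<open>X\<close>
  is followed by a gap free of \<open>X \<union> Y\<close> and then an element of \<open>Y\<close>; this gap has at least \<open>|P|\<close>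
  vertices, as \<open>P\<close> could replace it. Counting now contradicts the degree condition.
\<close>

section \<open>Paths and cycles as vertex lists\<close>

definition simple_path :: "('a \<Rightarrow> 'a \<Rightarrow> bool) \<Rightarrow> 'a list \<Rightarrow> bool" where
  "simple_path E xs \<longleftrightarrow> xs \<noteq> [] \<and> distinct xs \<and> successively E xs"

text \<open>A list of two vertices counts as a cycle when both opposite arcs are present. Singletons
  need a loop, so for irreflexive \<open>E\<close> they never qualify.\<close>

definition simple_cycle :: "('a \<Rightarrow> 'a \<Rightarrow> bool) \<Rightarrow> 'a list \<Rightarrow> bool" where
  "simple_cycle E xs \<longleftrightarrow> simple_path E xs \<and> E (last xs) (hd xs)"

lemma simple_cycle_rotate:
  assumes "simple_cycle E (xs @ ys)"
  shows "simple_cycle E (ys @ xs)"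
proof (cases "xs = [] \<or> ys = []")
  case False
  then have "xs \<noteq> []" "ys \<noteq> []" by simp_all
  with assms show ?thesis
    by (simp add: simple_cycle_def simple_path_def successively_append_iff Int_commute)
qed (use assms in auto)

lemma simple_cycle_insert:
  assumes "simple_cycle E (xs @ ys)" "xs \<noteq> []" "ys \<noteq> []"
    and "simple_path E zs" "set zs \<inter> set (xs @ ys) = {}"
    and "E (last xs) (hd zs)" "E (last zs) (hd ys)"
  shows "simple_cycle E (xs @ zs @ ys)"
proof -
  have "zs \<noteq> []" using assms(4) by (simp add: simple_path_def)
  moreover have "set xs \<inter> set zs = {}" "set zs \<inter> set ys = {}" using assms(5) by auto
  ultimately show ?thesis using assms
    by (simp add: simple_cycle_def simple_path_def successively_append_iff Int_Un_distrib)
qed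

section \<open>Longest paths and a long cycle\<close>

lemma ex_longest_distinct_list:
  assumes "finite S" "P xs" "\<And>ys. P ys \<Longrightarrow> distinct ys \<and> set ys \<subseteq> S"
  obtains zs where "P zs" "\<And>ys. P ys \<Longrightarrow> length ys \<le> length zs"
proof -
  have "length ys \<le> card S" if "P ys" for ys
    using card_mono[OF assms(1), of "set ys"] assms(3)[OF that] by (simp add: distinct_card)
  then have "\<exists>zs. P zs \<and> (\<forall>ys. P ys \<longrightarrow> length ys \<le> length zs)"
    using ex_has_greatest_nat[of P xs length "Suc (card S)"] assms(2)
    by (simp add: less_Suc_eq_le)
  then show ?thesis using that by blast
qed

lemma ex_longest_simple_path:
  assumes "finite S" "S \<noteq> {}"
  obtains P where "simple_path E P" "set P \<subseteq> S"
    "\<And>Q. simple_path E Q \<Longrightarrow> set Q \<subseteq> S \<Longrightarrow> length Q \<le> length P"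
proof -
  from assms(2) obtain x where "x \<in> S" by blast
  let ?P = "\<lambda>xs. simple_path E xs \<and> set xs \<subseteq> S"
  have "?P [x]" using \<open>x \<in> S\<close> by (simp add: simple_path_def)
  moreover have "distinct ys \<and> set ys \<subseteq> S" if "?P ys" for ys
    using that by (simp add: simple_path_def)
  ultimately obtain P where "?P P" "\<And>Q. ?P Q \<Longrightarrow> length Q \<le> length P"
    using ex_longest_distinct_list[of S ?P, OF assms(1)] by blast
  then show ?thesis using that by blast
qed

text \<open>Otherwise \<open>w # P\<close> would be a longer path in \<open>S\<close>. With
  \<open>S\<close> the complement of a cycle, this confines the in-neighbours of \<open>hd P\<close>
  to the path and the cycle.\<close>

lemma longest_path_hd:
  assumes "simple_path E P" "set P \<subseteq> S"
    and "\<And>Q. simple_path E Q \<Longrightarrow> set Q \<subseteq> S \<Longrightarrow> length Q \<le> length P"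
    and "E w (hd P)" "w \<in> S"
  shows "w \<in> set P"
proof (rule ccontr)
  assume "w \<notin> set P"
  with assms have "simple_path E (w # P)"
    by (auto simp: simple_path_def successively_Cons)
  with assms show False by fastforce
qed

lemma longest_path_last:
  assumes "simple_path E P" "set P \<subseteq> S"
    and "\<And>Q. simple_path E Q \<Longrightarrow> set Q \<subseteq> S \<Longrightarrow> length Q \<le> length P"
    and "E (last P) w" "w \<in> S"
  shows "w \<in> set P"
proof (rule ccontr)
  assume "w \<notin> set P"
  with assms have "simple_path E (P @ [w])"
    by (auto simp: simple_path_def successively_append_iff)
  with assms show False by fastforce
qed

text \<open>All out-neighbours of the end of a longest path lie on the path. Closing the path at the
  earliest of them gives a cycle through the end and all of its out-neighbours.\<close>

lemma ex_long_cycle: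
  assumes "finite V" "V \<noteq> {}" and irr: "\<And>v. \<not> E v v"
    and deg: "\<And>v. v \<in> V \<Longrightarrow> m \<le> card {w \<in> V. E v w}" and "0 < m"
  obtains C where "simple_cycle E C" "set C \<subseteq> V" "m < length C"
proof -
  obtain P where P: "simple_path E P" "set P \<subseteq> V"
    and max: "\<And>Q. simple_path E Q \<Longrightarrow> set Q \<subseteq> V \<Longrightarrow> length Q \<le> length P"
    using ex_longest_simple_path[OF assms(1,2)] by metis
  let ?u = "last P"
  let ?N = "{w \<in> V. E ?u w}"
  have ne: "P \<noteq> []" using P by (simp add: simple_path_def)
  have u: "?u \<in> V" using P ne by auto
  have N: "?N \<subseteq> set P" using longest_path_last[OF P max] by auto
  have "?N \<noteq> {}" using deg[OF u] \<open>0 < m\<close> by (metis card.empty not_less)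
  then have "\<exists>x\<in>set P. E ?u x" using N by auto
  then obtain as y bs where split: "P = as @ y # bs" "E ?u y" "\<forall>x\<in>set as. \<not> E ?u x"
    using split_list_first_prop[of P "E ?u"] by blast
  let ?C = "y # bs"
  have "simple_cycle E ?C"
    using P split by (auto simp: simple_cycle_def simple_path_def successively_append_iff)
  moreover have "m < length ?C"
  proof -
    \<comment> \<open>Without loops, \<open>?u\<close> is not its own out-neighbour, and this extra
      vertex makes the bound strict.\<close>
    have "insert ?u ?N \<subseteq> set ?C" using N split by auto
    then have "card (insert ?u ?N) \<le> card (set ?C)" by (intro card_mono) auto
    also have "\<dots> \<le> length ?C" by (rule card_length)
    finally show ?thesis using deg[OF u] irr assms(1) by simp
  qed
  ultimately show ?thesis using that split P by simp
qed

section \<open>Counting along a cycle\<close>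

text \<open>Each of the \<open>length xs\<close> consecutive pairs contributes at most one: its
  first entry to \<open>X\<close> or its second to \<open>Y\<close>. The extra 1 accounts for the
  last entry being in \<open>X\<close>.\<close>

lemma count_no_consecutive:
  assumes "successively (\<lambda>a b. \<not> (a \<in> X \<and> b \<in> Y)) (a # xs)"
  shows "length (filter (\<lambda>x. x \<in> X) (a # xs)) + length (filter (\<lambda>x. x \<in> Y) xs)
    \<le> length xs + 1"
  using assms
proof (induction xs arbitrary: a)
  case (Cons b xs)
  then have "successively (\<lambda>a b. \<not> (a \<in> X \<and> b \<in> Y)) (b # xs)" "\<not> (a \<in> X \<and> b \<in> Y)"
    by simp_all
  with Cons.IH[of b] show ?case by auto
qed auto

lemma not_successively_imp:
  assumes "\<not> successively R xs"
  shows "\<exists>us a b vs. xs = us @ a # b # vs \<and> \<not> R a b"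
  using assms
proof (induction xs rule: induct_list012)
  case (3 x y zs)
  show ?case
  proof (cases "R x y")
    case True
    then obtain us a b vs where "y # zs = us @ a # b # vs" "\<not> R a b"
      using 3 by auto
    then have "x # y # zs = (x # us) @ a # b # vs \<and> \<not> R a b" by simp
    then show ?thesis by blast
  next
    case False
    then have "x # y # zs = [] @ x # y # zs \<and> \<not> R x y" by simp
    then show ?thesis by blast
  qed
qed auto

lemma card_le_filter:
  assumes "X \<subseteq> set xs"
  shows "card X \<le> length (filter (\<lambda>x. x \<in> X) xs)"
proof -
  have "X = set (filter (\<lambda>x. x \<in> X) xs)" using assms by auto
  then show ?thesis by (metis card_length)
qed

text \<open>Read cyclically, \<open>gs\<close> is what lies between an element of \<open>X\<close>
  and the next element \<open>y\<close> of \<open>Y\<close>, with nothing from either set in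
  between. The gap may be empty, and \<open>y\<close> may also be that element of
  \<open>X\<close>.\<close>

lemma ex_rotation_with_gap:
  assumes "simple_cycle E C" "X \<subseteq> set C" "Y \<subseteq> set C" "X \<noteq> {}" "Y \<noteq> {}"
  obtains gs y zs where "simple_cycle E (gs @ y # zs)" "set (gs @ y # zs) = set C"
    "y \<in> Y" "last (y # zs) \<in> X" "set gs \<inter> (X \<union> Y) = {}"
proof -
  from assms obtain x where "x \<in> X" "x \<in> set C" by auto
  then obtain as bs where C: "C = as @ x # bs" by (meson split_list)
  \<comment> \<open>Rotated to end in \<open>X\<close>, the cycle is cut at its first element of
    \<open>Y\<close>. If elements of \<open>X\<close> precede that one, a second rotation cuts right
    after the last of them.\<close>
  define D where "D = bs @ as @ [x]"
  have D: "simple_cycle E D" "set D = set C" "last D = x"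
    using assms(1) simple_cycle_rotate[of E "as @ [x]" bs] by (auto simp: C D_def)
  have "\<exists>y\<in>set D. y \<in> Y" using assms D by auto
  then obtain ps y qs where split: "D = ps @ y # qs" "y \<in> Y" "\<forall>z\<in>set ps. z \<notin> Y"
    using split_list_first_prop[of D "\<lambda>z. z \<in> Y"] by blast
  show ?thesis
  proof (cases "set ps \<inter> X = {}")
    case True
    then show ?thesis using that[of ps y qs] D split \<open>x \<in> X\<close> by auto
  next
    case False
    then have "\<exists>z\<in>set ps. z \<in> X" by auto
    then obtain us z vs where ps: "ps = us @ z # vs" "z \<in> X" "\<forall>w\<in>set vs. w \<notin> X"
      using split_list_last_prop[of ps "\<lambda>z. z \<in> X"] by blast
    have "simple_cycle E (vs @ y # (qs @ us @ [z]))"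
      using D(1) simple_cycle_rotate[of E "us @ [z]" "vs @ y # qs"] by (simp add: split ps)
    then show ?thesis
      using that[of vs y "qs @ us @ [z]"] D(2) split ps by auto
  qed
qed

section \<open>Ghouila-Houri's theorem\<close>

theorem ghouila_houri:
  assumes fin: "finite V" and ne: "V \<noteq> {}" and irr: "\<And>v. \<not> E v v"
    and outd: "\<And>v. v \<in> V \<Longrightarrow> card V \<le> 2 * card {w \<in> V. E v w}"
    and ind: "\<And>v. v \<in> V \<Longrightarrow> card V \<le> 2 * card {w \<in> V. E w v}"
  obtains C where "simple_cycle E C" "set C = V"
proof -
  \<comment> \<open>This is half of \<open>card V\<close> rounded up, the integer form of the degree
    bound.\<close>
  define m where "m = (card V + 1) div 2"
  have pos: "0 < card V" using fin ne by (simp add: card_gt_0_iff)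
  have outm: "m \<le> card {w \<in> V. E v w}" and inm: "m \<le> card {w \<in> V. E w v}" if "v \<in> V" for v
    using outd[OF that] ind[OF that] by (auto simp: m_def)
  have m0: "0 < m" using pos by (simp add: m_def)
  obtain C0 where C0: "simple_cycle E C0" "set C0 \<subseteq> V" "m < length C0"
    using ex_long_cycle[OF fin ne irr outm m0] by metis
  let ?cyc = "\<lambda>C. simple_cycle E C \<and> set C \<subseteq> V"
  obtain C where C: "simple_cycle E C" "set C \<subseteq> V"
    and maxC: "\<And>D. simple_cycle E D \<Longrightarrow> set D \<subseteq> V \<Longrightarrow> length D \<le> length C"
  proof -
    have "distinct D \<and> set D \<subseteq> V" if "?cyc D" for D
      using that by (simp add: simple_cycle_def simple_path_def)
    then obtain C where "?cyc C" "\<And>D. ?cyc D \<Longrightarrow> length D \<le> length C"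
      using ex_longest_distinct_list[of V ?cyc C0, OF fin] C0 by blast
    then show ?thesis using that by blast
  qed
  have distC: "distinct C" using C by (simp add: simple_cycle_def simple_path_def)
  have lenC: "m < length C" using maxC[OF C0(1,2)] C0(3) by simp
  have "set C = V"
  proof (rule ccontr)
    assume "set C \<noteq> V"
    define W where "W = V - set C"
    have W: "finite W" "W \<noteq> {}" using C \<open>set C \<noteq> V\<close> fin by (auto simp: W_def)
    obtain P where P: "simple_path E P" "set P \<subseteq> W"
      and maxP: "\<And>Q. simple_path E Q \<Longrightarrow> set Q \<subseteq> W \<Longrightarrow> length Q \<le> length P"
      using ex_longest_simple_path[OF W] by metis
    have Pne: "P \<noteq> []" and distP: "distinct P" using P by (auto simp: simple_path_def)
    let ?k = "length P"
    have kW: "?k \<le> card W" using P(2) distP W(1) by (metis card_mono distinct_card)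
    have "card W = card V - length C"
      using C(2) distC fin by (simp add: W_def card_Diff_subset distinct_card)
    moreover have "length C \<le> card V" using C(2) distC fin by (metis card_mono distinct_card)
    ultimately have klen: "length C + ?k \<le> card V" using kW by linarith
    \<comment> \<open>Since \<open>length C\<close> is at least \<open>m + 1\<close> and
      \<open>card V\<close> at most \<open>2 * m\<close>, fewer than \<open>m\<close> vertices
      remain for \<open>P\<close>. This makes \<open>X\<close> and \<open>Y\<close>
      nonempty.\<close>
    then have km: "?k < m" using lenC by (auto simp: m_def)
    define X where "X = {w \<in> set C. E w (hd P)}"
    define Y where "Y = {w \<in> set C. E (last P) w}"
    have disj: "set P \<inter> set C = {}" using P(2) by (auto simp: W_def)
    have hdV: "hd P \<in> V" "last P \<in> V" 
      using P(2) hd_in_set[OF Pne] last_in_set[OF Pne] unfolding W_def by blast+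
    \<comment> \<open>At most \<open>?k - 1\<close> in-neighbours of \<open>hd P\<close> are on
      \<open>P\<close>, because \<open>hd P\<close> is not one of them. The rest are in
      \<open>X\<close>.\<close>
    have cardX: "m + 1 \<le> card X + ?k"
    proof -
      have "{w \<in> V. E w (hd P)} \<subseteq> X \<union> (set P - {hd P})"
        using longest_path_hd[OF P maxP] irr by (auto simp: X_def W_def)
      then have "card {w \<in> V. E w (hd P)} \<le> card (X \<union> (set P - {hd P}))"
        by (intro card_mono) (auto simp: X_def)
      also have "\<dots> \<le> card X + card (set P - {hd P})" by (rule card_Un_le)
      also have "card (set P - {hd P}) = ?k - 1" using Pne distP by (simp add: distinct_card)
      finally show ?thesis using inm[OF hdV(1)] Pne by (cases P) auto
    qed
    have cardY: "m + 1 \<le> card Y + ?k"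
    proof -
      have "{w \<in> V. E (last P) w} \<subseteq> Y \<union> (set P - {last P})"
        using longest_path_last[OF P maxP] irr by (auto simp: Y_def W_def)
      then have "card {w \<in> V. E (last P) w} \<le> card (Y \<union> (set P - {last P}))"
        by (intro card_mono) (auto simp: Y_def)
      also have "\<dots> \<le> card Y + card (set P - {last P})" by (rule card_Un_le)
      also have "card (set P - {last P}) = ?k - 1" using Pne distP by (simp add: distinct_card)
      finally show ?thesis using outm[OF hdV(2)] Pne by (cases P) auto
    qed
    have "X \<noteq> {}" "Y \<noteq> {}" using cardX cardY km by auto
    then obtain gs y zs where gap: "simple_cycle E (gs @ y # zs)" "set (gs @ y # zs) = set C"
      "y \<in> Y" "last (y # zs) \<in> X" "set gs \<inter> (X \<union> Y) = {}"
      using ex_rotation_with_gap[OF C(1), of X Y] by (auto simp: X_def Y_def)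
    have dist: "distinct (gs @ y # zs)" using gap(1) by (simp add: simple_cycle_def simple_path_def)
    have len: "length C = length gs + length zs + 1"
      using gap(2) distC distinct_card[OF dist] distinct_card[OF distC] by simp
    have gapP: "?k \<le> length gs"
    proof -
      \<comment> \<open>\<open>P\<close> replaces the gap: its start is entered from
        \<open>last (y # zs)\<close> in \<open>X\<close>, and its end leads to \<open>y\<close> in
        \<open>Y\<close>.\<close>
      have "simple_cycle E (P @ y # zs)"
        using gap P disj dist
        by (auto simp: simple_cycle_def simple_path_def successively_append_iff X_def Y_def)
      moreover have "set (P @ y # zs) \<subseteq> V" using gap(2) C(2) P(2) by (auto simp: W_def)
      ultimately have "length (P @ y # zs) \<le> length C" by (rule maxC)
      then show ?thesis using len by simp
    qed
    have succ: "successively (\<lambda>a b. \<not> (a \<in> X \<and> b \<in> Y)) (y # zs)"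
    proof (rule ccontr)
      assume "\<not> ?thesis"
      then obtain us a b vs where split: "y # zs = us @ a # b # vs" "a \<in> X" "b \<in> Y"
        using not_successively_imp by blast
      \<comment> \<open>Otherwise \<open>P\<close> fits between \<open>a\<close> and
        \<open>b\<close>, which lengthens the cycle.\<close>
      have "simple_cycle E ((gs @ us @ [a]) @ P @ (b # vs))"
      proof (rule simple_cycle_insert)
        show "simple_cycle E ((gs @ us @ [a]) @ b # vs)" using gap(1) split(1) by simp
        show "set P \<inter> set ((gs @ us @ [a]) @ b # vs) = {}"
          using gap(2) split(1) disj by simp
      qed (use split(2,3) P(1) in \<open>simp_all add: X_def Y_def\<close>)
      moreover have "set ((gs @ us @ [a]) @ P @ (b # vs)) \<subseteq> V"
        using gap(2) C(2) P(2) by (auto simp: W_def split)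
      ultimately have "length ((gs @ us @ [a]) @ P @ (b # vs)) \<le> length C" by (rule maxC)
      moreover have "length C = length gs + length (us @ a # b # vs)"
        using len arg_cong[OF split(1), of length] by simp
      ultimately show False using Pne by simp
    qed
    have "X \<subseteq> set (y # zs)" using gap(2,5) by (auto simp: X_def)
    then have 1: "card X \<le> length (filter (\<lambda>x. x \<in> X) (y # zs))" by (rule card_le_filter)
    have "Y \<subseteq> set (y # zs)" using gap(2,5) by (auto simp: Y_def)
    then have "card Y \<le> length (filter (\<lambda>x. x \<in> Y) (y # zs))" by (rule card_le_filter)
    \<comment> \<open>The count along consecutive pairs does not see whether the first entry
      \<open>y\<close> is in \<open>Y\<close>, hence the 1.\<close>
    then have 2: "card Y \<le> 1 + length (filter (\<lambda>x. x \<in> Y) zs)" by (simp split: if_splits)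
    have "card X + card Y \<le> length zs + 2"
      using count_no_consecutive[OF succ] 1 2 by linarith
    \<comment> \<open>Altogether \<open>2 * (m + 1 - ?k)\<close> is at most
      \<open>length zs + 2\<close>, hence at most \<open>length C - ?k + 1\<close> and so at most
      \<open>card V - 2 * ?k + 1\<close>. This gives \<open>2 * m < card V\<close>.\<close>
    then show False using cardX cardY gapP len klen by (simp add: m_def)
  qed
  then show ?thesis using that C by blast
qed

section \<open>Arborescences from parent maps\<close>

text \<open>The rank \<open>h\<close> makes the parent relation well-founded: iterating
  \<open>p\<close> must end in \<open>r\<close>. Connectedness and the absence of cycles both come
  from it.\<close>

locale parent_map = digraph G for G :: "('a, 'b) pre_digraph" +
  fixes r :: 'a and p :: "'a \<Rightarrow> 'a" and h :: "'a \<Rightarrow> nat"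
  assumes root: "r \<in> verts G"
    and parent: "\<And>v. v \<in> verts G \<Longrightarrow> v \<noteq> r \<Longrightarrow> p v \<rightarrow>\<^bsub>G\<^esub> v"
    and rank: "\<And>v. v \<in> verts G \<Longrightarrow> v \<noteq> r \<Longrightarrow> h (p v) < h v"
begin

text \<open>The value \<open>p r\<close> is arbitrary, so arcs into \<open>r\<close> are excluded
  explicitly. As \<open>G\<close> has no parallel arcs, exactly one arc is kept for every other
  vertex.\<close>

definition T :: "('a, 'b) pre_digraph" where
  "T = G\<lparr>arcs := {e \<in> arcs G. head G e \<noteq> r \<and> tail G e = p (head G e)}\<rparr>"

lemma T_simps [simp]: "verts T = verts G" "tail T = tail G" "head T = head G"
  by (simp_all add: T_def)

lemma arcs_T: "arcs T = {e \<in> arcs G. head G e \<noteq> r \<and> tail G e = p (head G e)}"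
  by (simp add: T_def)

lemma dominates_T: "u \<rightarrow>\<^bsub>T\<^esub> v \<longleftrightarrow> v \<in> verts G \<and> v \<noteq> r \<and> u = p v"
proof
  assume "v \<in> verts G \<and> v \<noteq> r \<and> u = p v"
  moreover from this obtain e where "e \<in> arcs G" "tail G e = p v" "head G e = v"
    using parent by (meson reachableE)
  ultimately show "u \<rightarrow>\<^bsub>T\<^esub> v" by (force simp: arcs_ends_conv arcs_T)
qed (auto simp: arcs_ends_conv arcs_T)

lemma digraph_T: "digraph T"
proof unfold_locales
  fix e1 e2
  assume "e1 \<in> arcs T" "e2 \<in> arcs T" "arc_to_ends T e1 = arc_to_ends T e2"
  then show "e1 = e2" by (intro no_multi_arcs) (simp_all add: arcs_T arc_to_ends_def)
next
  fix e assume "e \<in> arcs T"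
  then have "e \<in> arcs G" by (simp add: arcs_T)
  then show "tail T e \<in> verts T" "head T e \<in> verts T" "tail T e \<noteq> head T e"
    by (simp_all add: no_loops)
qed (simp_all add: arcs_T)

lemma spanning_T: "spanning T G"
  using digraph_T wf_digraph_axioms
  by (auto simp: spanning_def subgraph_def compatible_def arcs_T digraph_def fin_digraph_def)

lemma oriented_T: "oriented T"
  unfolding oriented_def
proof (intro conjI allI impI notI digraph_T)
  fix u v assume "u \<rightarrow>\<^bsub>T\<^esub> v" "v \<rightarrow>\<^bsub>T\<^esub> u"
  then show False using rank[of u] rank[of v] by (auto simp: dominates_T)
qed

lemma in_degree_root: "in_degree T r = 0"
  by (simp add: in_degree_def in_arcs_def arcs_T)

lemma in_degree_nonroot:
  assumes "v \<in> verts G" "v \<noteq> r"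
  shows "in_degree T v = 1"
proof -
  obtain e where e: "e \<in> arcs G" "tail G e = p v" "head G e = v"
    using parent[OF assms] by (meson reachableE)
  then have "in_arcs T v = {e}"
    using assms by (auto simp: in_arcs_def arcs_T arc_to_ends_def intro!: no_multi_arcs)
  then show ?thesis by (simp add: in_degree_def)
qed

lemma parcs_sym: "(u, v) \<in> parcs (mk_symmetric T) \<longleftrightarrow> u \<rightarrow>\<^bsub>T\<^esub> v \<or> v \<rightarrow>\<^bsub>T\<^esub> u"
  by (auto simp: parcs_mk_symmetric arcs_ends_conv)

lemma reachable_T: "v \<in> verts G \<Longrightarrow> r \<rightarrow>\<^sup>*\<^bsub>T\<^esub> v"
proof (induction "h v" arbitrary: v rule: less_induct)
  case less
  interpret T: digraph T by (rule digraph_T)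
  show ?case
  proof (cases "v = r")
    case False
    have "p v \<in> verts G" using parent[OF less.prems False] adj_in_verts by blast
    then have "r \<rightarrow>\<^sup>*\<^bsub>T\<^esub> p v" using less False rank by blast
    moreover have "p v \<rightarrow>\<^bsub>T\<^esub> v" using less.prems False by (simp add: dominates_T)
    ultimately show ?thesis by (rule T.reachable_adj_trans)
  qed (use root in auto)
qed

lemma connected_T: "connected T"
proof -
  interpret T: digraph T by (rule digraph_T)
  interpret S: pair_wf_digraph "mk_symmetric T" by (rule T.wellformed_mk_symmetric)
  have *: "r \<rightarrow>\<^sup>*\<^bsub>mk_symmetric T\<^esub> v" if "v \<in> verts G" for v
    using that by (intro T.reachable_mk_symmetricI reachable_T)
  have "u \<rightarrow>\<^sup>*\<^bsub>mk_symmetric T\<^esub> v" if "u \<in> verts G" "v \<in> verts G" for u v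
    using *[OF that(1)] *[OF that(2)] symmetric_reachable[OF symmetric_mk_symmetric]
    by (meson S.reachable_trans)
  then show ?thesis using root by (auto simp: connected_def strongly_connected_def)
qed

text \<open>Expressing walks by \<open>successively\<close> and the two end conditions makes it easy
  to rotate a closed walk.\<close>

lemma pcas_closed:
  assumes "pcas u q v" "q \<noteq> []"
  shows "fst (hd q) = u \<and> snd (last q) = v \<and> successively (\<lambda>a b. snd a = fst b) q"
  using assms by (induction u q v rule: pcas.induct) (auto simp: successively_Cons)

text \<open>
  On a cycle, both neighbours of a vertex of maximal rank would have to be its parent.
\<close>

lemma no_cycle_T:
  assumes "pre_digraph.cycle (with_proj (mk_symmetric T)) q" "3 \<le> length q"
  shows False
proof -
  obtain u where u: "set q \<subseteq> parcs (mk_symmetric T)" "pcas u q u" "distinct (tl (pawalk_verts u q))"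
    using assms(1)
    by (auto simp: pre_digraph.cycle_def pre_digraph.awalk_def cas_with_proj_eq
        awalk_verts_with_proj_eq)
  have ne: "q \<noteq> []" using assms(2) by auto
  \<comment> \<open>Arcs of \<open>mk_symmetric T\<close> are pairs of endpoints, so the second
    components list each vertex of the cycle once.\<close>
  have dist: "distinct (map snd q)"
    using u(2,3) ne pre_digraph.awalk_verts_conv'[of "with_proj (mk_symmetric T)" u q u]
    by (simp add: cas_with_proj_eq awalk_verts_with_proj_eq)
  note closed = pcas_closed[OF u(2) ne]
  obtain e where e: "e \<in> set q" "\<And>x. x \<in> set q \<Longrightarrow> h (snd x) \<le> h (snd e)"
  proof -
    let ?H = "(\<lambda>x. h (snd x)) ` set q"
    have "Max ?H \<in> ?H" using ne by (intro Max_in) auto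
    then obtain e where "e \<in> set q" "Max ?H = h (snd e)" by auto
    moreover have "h (snd x) \<le> Max ?H" if "x \<in> set q" for x using that by simp
    ultimately show ?thesis using that by metis
  qed
  obtain as bs where q: "q = as @ e # bs" using e(1) by (meson split_list)
  \<comment> \<open>Rotating puts \<open>e\<close>, which enters a vertex of maximal rank, at the
    end. The first arc of \<open>q'\<close> then leaves that vertex, and the last one enters the
    tail of \<open>e\<close>.\<close>
  define q' where "q' = bs @ as"
  have succ: "successively (\<lambda>a b. snd a = fst b) (q' @ [e])"
    and hd: "fst (hd q') = snd e"
    using closed assms(2) unfolding q q'_def
    by (cases "as = []"; cases "bs = []"; force simp: successively_append_iff successively_Cons)+
  have dist': "distinct (map snd (q' @ [e]))" using dist by (auto simp: q q'_def)
  \<comment> \<open>Length at least 3 is what makes \<open>x\<close> and \<open>y\<close> different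
    arcs, so that the two neighbours of \<open>snd e\<close> are distinct.\<close>
  have "2 \<le> length q'" using assms(2) by (simp add: q q'_def)
  then obtain x y ms where q': "q' = x # ms @ [y]"
    by (cases q'; cases "tl q'" rule: rev_cases) auto
  have "set q = insert e (set q')" by (auto simp: q q'_def)
  then have in_q: "x \<in> set q" "y \<in> set q" by (simp_all add: q')
  \<comment> \<open>A neighbour is a parent or a child, and a child would have larger rank.\<close>
  have parent_if: "snd z = p (snd e)"
    if "(snd e, snd z) \<in> parcs (mk_symmetric T) \<or> (snd z, snd e) \<in> parcs (mk_symmetric T)"
      "z \<in> set q" for z
    using that(1) e(2)[OF that(2)] rank[of "snd z"] by (auto simp: parcs_sym dominates_T)
  have "(snd e, snd x) = x" using hd by (simp add: q' prod_eq_iff)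
  then have "snd x = p (snd e)" using parent_if[of x] in_q u(1) by (metis subsetD)
  moreover have "(snd y, snd e) = e"
    using succ by (simp add: q' successively_append_iff successively_Cons prod_eq_iff)
  then have "snd y = p (snd e)" using parent_if[of y] in_q e(1) u(1) by (metis subsetD)
  ultimately show False using dist' by (simp add: q')
qed

lemma spanning_arborescence_T: "spanning_arborescence T G"
  unfolding spanning_arborescence_def arborescence_def directed_tree_def
  using oriented_T connected_T no_cycle_T spanning_T root in_degree_root in_degree_nonroot
  by auto

text \<open>A vertex that is no one's parent can be adjacent only to its own parent, so it has
  degree at most 1.\<close>

lemma tree_int_T: "tree_int T \<subseteq> p ` (verts G - {r})"
proof
  fix v assume v: "v \<in> tree_int T"
  show "v \<in> p ` (verts G - {r})"
  proof (rule ccontr)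
    assume "v \<notin> p ` (verts G - {r})"
    then have "out_arcs (with_proj (mk_symmetric T)) v \<subseteq> {(v, p v)}"
      by (auto simp: parcs_sym dominates_T)
    then have "out_degree (with_proj (mk_symmetric T)) v \<le> card {(v, p v)}"
      unfolding out_degree_def by (rule card_mono[rotated]) simp
    then show False using v by (simp add: tree_int_def)
  qed
qed

lemma tail_T: "e \<in> arcs T \<Longrightarrow> tail G e \<in> p ` (verts G - {r})"
  by (auto simp: arcs_T)

end

section \<open>Arborescences with all inner vertices on a path\<close>

text \<open>The path guarantees each of its vertices but the first an earlier in-neighbour on
  \<open>A\<close>, and \<open>dom\<close> serves the others. Parents are chosen freely among such
  in-neighbours, so the tree may use other arcs than those of the path.\<close>

lemma spanning_arborescence_from_path:
  assumes "digraph G" and path: "simple_path (\<lambda>u v. u \<rightarrow>\<^bsub>G\<^esub> v) A" and "set A \<subseteq> verts G"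
    and dom: "\<And>v. v \<in> verts G - set A \<Longrightarrow> \<exists>u\<in>set A. u \<rightarrow>\<^bsub>G\<^esub> v"
  obtains T where "spanning_arborescence T G" "tree_int T \<subseteq> set A"
    "\<And>e. e \<in> arcs T \<Longrightarrow> tail G e \<in> set A"
proof -
  \<comment> \<open>the index of \<open>v\<close> on the path, and \<open>length A\<close> if \<open>v\<close> is not on it\<close>
  define h where "h v = length (takeWhile (\<lambda>x. x \<noteq> v) A)" for v
  have "\<exists>u\<in>set A. u \<rightarrow>\<^bsub>G\<^esub> v \<and> h u < h v" if v: "v \<in> verts G - {hd A}" for v
  proof (cases "v \<in> set A")
    case True
    then obtain as bs where A: "A = as @ v # bs" by (meson split_list)
    then have "as \<noteq> []" using v by auto
    then obtain as' u where as: "as = as' @ [u]" by (meson rev_exhaust)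
    have "u \<rightarrow>\<^bsub>G\<^esub> v" using path by (simp add: simple_path_def A as successively_append_iff)
    moreover have "h u < h v"
    proof -
      have "distinct (as' @ u # v # bs)" using path by (simp add: simple_path_def A as)
      then have "h u = length as'" "h v = Suc (length as')"
        by (auto simp: h_def A as takeWhile_append)
      then show ?thesis by simp
    qed
    ultimately show ?thesis using A as by auto
  next
    case False
    then obtain u where u: "u \<in> set A" "u \<rightarrow>\<^bsub>G\<^esub> v" using dom v by auto
    from False have "takeWhile (\<lambda>x. x \<noteq> v) A = A" by (auto simp: takeWhile_eq_all_conv)
    moreover have "h u < length A"
      unfolding h_def using u(1) by (metis (mono_tags, lifting) length_takeWhile_le
        nat_less_le takeWhile_eq_take take_all_iff takeWhile_eq_all_conv order_refl)
    ultimately show ?thesis using u by (metis h_def)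
  qed
  then obtain p where p: "\<And>v. v \<in> verts G - {hd A} \<Longrightarrow> p v \<in> set A \<and> p v \<rightarrow>\<^bsub>G\<^esub> v \<and> h (p v) < h v"
    by metis
  interpret digraph G by fact
  have "hd A \<in> verts G" using path assms(3) hd_in_set[of A] by (auto simp: simple_path_def)
  then interpret parent_map G "hd A" p h
    by unfold_locales (simp_all add: p)
  have sub: "p ` (verts G - {hd A}) \<subseteq> set A" using p by blast
  show ?thesis
  proof (rule that[OF spanning_arborescence_T])
    show "tree_int T \<subseteq> set A" using tree_int_T sub by (rule subset_trans)
    show "tail G e \<in> set A" if "e \<in> arcs T" for e using tail_T[OF that] sub by (rule rev_subsetD)
  qed
qed

section \<open>Splitting a Hamilton cycle\<close>

text \<open>Without parallel arcs, \<open>tail G\<close> is injective on the arcs into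
  \<open>v\<close>, so arcs can be counted as neighbours.\<close>

lemma (in digraph) in_degree_eq_card: "in_degree G v = card {u \<in> verts G. u \<rightarrow>\<^bsub>G\<^esub> v}"
proof -
  have "inj_on (tail G) (in_arcs G v)"
    by (rule inj_onI) (auto intro: no_multi_arcs simp: arc_to_ends_def)
  moreover have "tail G ` in_arcs G v = {u \<in> verts G. u \<rightarrow>\<^bsub>G\<^esub> v}"
    by (auto simp: arcs_ends_conv)
  ultimately show ?thesis unfolding in_degree_def by (metis card_image)
qed

lemma (in digraph) out_degree_eq_card: "out_degree G v = card {u \<in> verts G. v \<rightarrow>\<^bsub>G\<^esub> u}"
proof -
  have "inj_on (head G) (out_arcs G v)"
    by (rule inj_onI) (auto intro: no_multi_arcs simp: arc_to_ends_def)
  moreover have "head G ` out_arcs G v = {u \<in> verts G. v \<rightarrow>\<^bsub>G\<^esub> u}"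
    by (auto simp: arcs_ends_conv)
  ultimately show ?thesis unfolding out_degree_def by (metis card_image)
qed

theorem theorem3p31:
  fixes G :: "('a, 'b) pre_digraph"
  assumes "digraph G"
    and "verts G \<noteq> {}"
    and "real (min_semidegree G) \<ge> real (card (verts G)) / 2"
  shows "\<exists>S. CISA G 2 S"
proof -
  interpret digraph G by fact
  let ?V = "verts G" and ?E = "\<lambda>u v. u \<rightarrow>\<^bsub>G\<^esub> v"
  have deg: "card ?V \<le> 2 * min_semidegree G" using assms(3) by linarith
  have ind: "card ?V \<le> 2 * card {u \<in> ?V. ?E u v}" if "v \<in> ?V" for v
  proof -
    have "min_in_degree G \<le> in_degree G v" using that by (simp add: min_in_degree_def)
    then show ?thesis using deg by (simp add: min_semidegree_def in_degree_eq_card)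
  qed
  have outd: "card ?V \<le> 2 * card {u \<in> ?V. ?E v u}" if "v \<in> ?V" for v
  proof -
    have "min_out_degree G \<le> out_degree G v" using that by (simp add: min_out_degree_def)
    then show ?thesis using deg by (simp add: min_semidegree_def out_degree_eq_card)
  qed
  have irr: "\<not> ?E v v" for v using adj_not_same by blast
  obtain C where C: "simple_cycle ?E C" "set C = ?V"
    using ghouila_houri[of ?V ?E, OF finite_verts assms(2) irr outd ind] by metis
  have dist: "distinct C" using C by (simp add: simple_cycle_def simple_path_def)
  have len: "length C = card ?V" using C(2) distinct_card[OF dist] by simp
  \<comment> \<open>A Hamilton cycle on one vertex would be a loop. Two vertices make both halves
    nonempty.\<close>
  have n2: "2 \<le> length C"
  proof (rule ccontr)
    assume "\<not> ?thesis"
    moreover have "C \<noteq> []" using C by (simp add: simple_cycle_def simple_path_def)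
    ultimately obtain x where "C = [x]" by (cases C rule: remdups_adj.cases) auto
    then show False using C irr by (simp add: simple_cycle_def)
  qed
  define A where "A = take (length C div 2) C"
  define B where "B = drop (length C div 2) C"
  have AB: "C = A @ B" by (simp add: A_def B_def)
  have lens: "2 * length A \<le> length C + 1" "2 * length B \<le> length C + 1"
    by (auto simp: A_def B_def)
  have ne: "A \<noteq> []" "B \<noteq> []" using n2 by (auto simp: A_def B_def)
  have disj: "set A \<inter> set B = {}" using dist by (simp add: AB)
  have paths: "simple_path ?E A" "simple_path ?E B"
    using C(1) ne by (auto simp: AB simple_cycle_def simple_path_def successively_append_iff)
  have VAB: "?V = set A \<union> set B" using C(2) by (simp add: AB)
  \<comment> \<open>Otherwise all in-neighbours of \<open>v\<close> lie in
    \<open>set Y - {v}\<close>, which has at most \<open>(length C - 1) / 2\<close> elements, too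
    few for the degree bound.\<close>
  have dom: "\<exists>u\<in>set X. ?E u v"
    if "v \<in> set Y" "?V = set X \<union> set Y" "2 * length Y \<le> length C + 1" for v X Y
  proof (rule ccontr)
    assume "\<not> ?thesis"
    then have "{u \<in> ?V. ?E u v} \<subseteq> set Y - {v}" using that(2) irr by auto
    then have "card {u \<in> ?V. ?E u v} \<le> card (set Y - {v})" by (intro card_mono) auto
    also have "\<dots> = card (set Y) - 1" using that(1) by simp
    also have "card (set Y) \<le> length Y" by (rule card_length)
    finally have "card {u \<in> ?V. ?E u v} \<le> length Y - 1" by simp
    then show False using ind[of v] that len by (cases Y) auto
  qed
  obtain T1 where T1: "spanning_arborescence T1 G" "tree_int T1 \<subseteq> set A"
      "\<And>e. e \<in> arcs T1 \<Longrightarrow> tail G e \<in> set A"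
    using spanning_arborescence_from_path[OF assms(1) paths(1)] dom[of _ B A] VAB lens by blast
  obtain T2 where T2: "spanning_arborescence T2 G" "tree_int T2 \<subseteq> set B"
      "\<And>e. e \<in> arcs T2 \<Longrightarrow> tail G e \<in> set B"
    using spanning_arborescence_from_path[OF assms(1) paths(2)] dom[of _ A B] VAB lens by blast
  have arcs: "arcs T1 \<inter> arcs T2 = {}" using T1(3) T2(3) disj by blast
  have int: "tree_int T1 \<inter> tree_int T2 = {}" using T1(2) T2(2) disj by blast
  \<comment> \<open>Disjointness alone would allow a single tree without arcs. Such a tree has only
    its root as a vertex, whereas \<open>G\<close> has at least two.\<close>
  have "T1 \<noteq> T2"
  proof
    assume "T1 = T2"
    then have "arcs T1 = {}" using arcs by simp
    then have "in_degree T1 v = 0" for v by (simp add: in_degree_def in_arcs_def)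
    moreover obtain r where "\<forall>v\<in>verts T1 - {r}. in_degree T1 v = 1"
      using T1(1) by (auto simp: spanning_arborescence_def arborescence_def)
    ultimately have "?V \<subseteq> {r}"
      using T1(1) by (auto simp: spanning_arborescence_def spanning_def)
    then have "card ?V \<le> card {r}" by (intro card_mono) auto
    then show False using n2 len by simp
  qed
  then have "CISA G 2 {T1, T2}"
    using T1(1) T2(1) arcs int by (auto simp: CISA_def)
  then show ?thesis by blast
qed

end
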